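(* Let $G=(V,E)$ be an $n$-vertex twin graph with Laplacian matrix $L$ and let $t=\left\lfloor\frac{n-1}{2}\right\rfloor$ denote the number of twins in $G$. Let $\mathcal{I}=\{i_1,\ldots,i_p\}\subset\{1,2,\ldots,n\}$ be a set of $p$ distinct indices and let $B=\begin{bmatrix}e_{i_1}&\cdots&e_{i_p}\end{bmatrix}\in\mathbb{R}^{n\times p}$. If $(L,B)$ is controllable then $p\geq t$.
   Context: Graphs are finite, simple and undirected, with vertex set $\{v_1,\ldots,v_n\}$. The Laplacian matrix is $L=D-A$, where $A$ is the adjacency matrix and $D$ the diagonal degree matrix. $e_i$ is the $i$th standard basis vector of $\mathbb{R}^n$. With $N(u)$ the set of neighbors of $u$, two distinct vertices $u,v$ are twins if $N(u)\setminus\{v\}=N(v)\setminus\{u\}$; the number of twins means the number of unordered twin pairs $\{u,v\}$. A matrix has simple spectrum if every eigenvalue has algebraic multiplicity one. A simple graph $G$ on $n$ vertices is a twin graph if its Laplacian has simple spectrum and its number of twins equals $\lfloor\frac{n-1}{2}\rfloor$ (the twin pairs are then pairwise disjoint). The pair $(L,B)$ is controllable if the linear control system $\dot x=Lx+Bu$ is controllable, i.e., the columns of $B,LB,\ldots,L^{n-1}B$ span $\mathbb{R}^n$. *)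

theory Defs
  imports
    Complex_Main
    "Graph_Theory.Digraph"
    "Jordan_Normal_Form.Char_Poly"
    "Jordan_Normal_Form.VS_Connect"
begin

(* The locale "graph" of Graph_Theory describes finite simple undirected graphs: an undirected
   edge {u,v} is a pair of opposite arcs, without loops or parallel arcs.  The vertices
   v_1, ..., v_n are the numbers 0, ..., n-1, in accordance with the 0-based indices of
   vectors and matrices in Jordan_Normal_Form. *)
definition graph_on :: "nat \<Rightarrow> (nat, 'b) pre_digraph \<Rightarrow> bool" where
  "graph_on n G \<longleftrightarrow> graph G \<and> verts G = {0..<n}"

definition neighbours :: "('a, 'b) pre_digraph \<Rightarrow> 'a \<Rightarrow> 'a set" where
  "neighbours G u = {v. u \<rightarrow>\<^bsub>G\<^esub> v}"

definition adjacency_mat :: "nat \<Rightarrow> (nat, 'b) pre_digraph \<Rightarrow> real mat" where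
  "adjacency_mat n G = mat n n (\<lambda>(i, j). if i \<rightarrow>\<^bsub>G\<^esub> j then 1 else 0)"

definition degree_mat :: "nat \<Rightarrow> (nat, 'b) pre_digraph \<Rightarrow> real mat" where
  "degree_mat n G = mat n n (\<lambda>(i, j). if i = j then real (card (neighbours G i)) else 0)"

definition laplacian :: "nat \<Rightarrow> (nat, 'b) pre_digraph \<Rightarrow> real mat" where
  "laplacian n G = degree_mat n G - adjacency_mat n G"

definition twins :: "('a, 'b) pre_digraph \<Rightarrow> 'a \<Rightarrow> 'a \<Rightarrow> bool" where
  "twins G u v \<longleftrightarrow> u \<in> verts G \<and> v \<in> verts G \<and> u \<noteq> v \<and>
     neighbours G u - {v} = neighbours G v - {u}"

definition num_twins :: "('a, 'b) pre_digraph \<Rightarrow> nat" where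
  "num_twins G = card {{u, v} | u v. twins G u v}"

(* All complex eigenvalues are taken into account, so that the notion is the right one for
   arbitrary real matrices, not only for symmetric ones. *)
definition simple_spectrum :: "real mat \<Rightarrow> bool" where
  "simple_spectrum A \<longleftrightarrow>
     (\<forall>k. eigenvalue (map_mat complex_of_real A) k \<longrightarrow>
          Polynomial.order k (char_poly (map_mat complex_of_real A)) = 1)"

definition twin_graph :: "nat \<Rightarrow> (nat, 'b) pre_digraph \<Rightarrow> bool" where
  "twin_graph n G \<longleftrightarrow> graph_on n G \<and> simple_spectrum (laplacian n G) \<and>
     int (num_twins G) = \<lfloor>(real n - 1) / 2\<rfloor>"

definition controllable :: "nat \<Rightarrow> real mat \<Rightarrow> real mat \<Rightarrow> bool" where
  "controllable n A B \<longleftrightarrow>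
     LinearCombinations.module.span class_ring (module_vec TYPE(real) n)
       (\<Union>k<n. set (cols (A ^\<^sub>m k * B))) = carrier_vec n"

end

theory Submission
  imports Defs
begin

text \<open>
  Swapping two twins \<open>u\<close> and \<open>v\<close> is an automorphism of the graph, so \<open>e\<^sub>u - e\<^sub>v\<close> is an
  eigenvector of the Laplacian \<open>L\<close>: the rows \<open>u\<close> and \<open>v\<close> of \<open>L\<close> differ by
  \<open>\<mu> (e\<^sub>u - e\<^sub>v)\<close> for a scalar \<open>\<mu>\<close> (\<open>laplacian_twin_row_diff\<close>). Two consequences are combined.

  A control must touch every twin pair. The hyperplane of the \<open>x\<close> with \<open>x\<^sub>u = x\<^sub>v\<close> is
  \<open>L\<close>-invariant, because \<open>(L x)\<^sub>u - (L x)\<^sub>v = \<mu> (x\<^sub>u - x\<^sub>v)\<close>. If neither \<open>u\<close> nor \<open>v\<close> is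
  in \<open>idx\<close>, it contains all columns of \<open>B\<close>, hence the whole controllable subspace, which is
  then proper (\<open>controllable_hits_twins\<close>).

  Twin pairs are disjoint. If \<open>u\<close> had two distinct twins \<open>v\<close> and \<open>w\<close>, then \<open>e\<^sub>v - e\<^sub>u\<close> and
  \<open>e\<^sub>w - e\<^sub>u\<close> would be independent eigenvectors for the same \<open>\<mu>\<close>, which would be a multiple
  root of the characteristic polynomial, against the simplicity of the spectrum (\<open>twins_unique\<close>).

  So the twin pairs are disjoint sets each of which contains an element of \<open>idx\<close>, and there are at
  most \<open>p\<close> of them.
\<close>

section \<open>A repeated factor of the characteristic polynomial\<close>

lemma det_scaled_row_diff:
  fixes M :: "'a :: comm_ring_1 mat"
  assumes M: "M \<in> carrier_mat n n" and i: "i < n" and k: "k < n" and ik: "i \<noteq> k"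
    and diff: "\<And>j. j < n \<Longrightarrow> M $$ (i, j) - M $$ (k, j) = c * r j"
  shows "det M = c * det (mat n n (\<lambda>(a, j). if a = i then r j else M $$ (a, j)))"
    (is "_ = c * det ?N")
proof -
  have "addrow (- 1) i k M = multrow i c ?N"
    using M i k diff by (intro eq_matI) (auto simp flip: diff)
  then have "det M = det (multrow i c ?N)"
    using det_addrow[OF k ik M, of "- 1"] by simp
  also have "\<dots> = c * det ?N"
    by (rule det_multrow[OF i]) simp
  finally show ?thesis .
qed

text \<open>
  This is the inequality between geometric and algebraic multiplicity for the two left eigenvectors
  \<open>e\<^sub>v - e\<^sub>u\<close> and \<open>e\<^sub>w - e\<^sub>u\<close>. Their special form allows a direct proof: subtracting row \<open>u\<close> of
  \<open>X I - A\<close> from the rows \<open>v\<close> and \<open>w\<close> makes both divisible by \<open>X - \<mu>\<close>.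
\<close>

lemma char_poly_square_dvd:
  fixes A :: "'a :: comm_ring_1 mat"
  assumes A: "A \<in> carrier_mat n n" and lt: "u < n" "v < n" "w < n"
    and ne: "u \<noteq> v" "u \<noteq> w" "v \<noteq> w"
    and v: "\<And>j. j < n \<Longrightarrow> A $$ (v, j) - A $$ (u, j) = \<mu> * (of_bool (j = v) - of_bool (j = u))"
    and w: "\<And>j. j < n \<Longrightarrow> A $$ (w, j) - A $$ (u, j) = \<mu> * (of_bool (j = w) - of_bool (j = u))"
  shows "[:- \<mu>, 1:] ^ 2 dvd char_poly A"
proof -
  let ?M = "char_poly_matrix A" and ?d = "[:- \<mu>, 1:]"
  define r :: "nat \<Rightarrow> nat \<Rightarrow> 'a poly" where "r s j = of_bool (j = s) - of_bool (j = u)" for s j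
  have M: "?M \<in> carrier_mat n n"
    using A by simp
  have entry: "?M $$ (i, j) = of_bool (i = j) * [:0, 1:] - [:A $$ (i, j):]" if "i < n" "j < n" for i j
    using A that by (simp add: char_poly_matrix_def)
  have row_diff: "?M $$ (s, j) - ?M $$ (u, j) = ?d * r s j"
    if s: "s < n" "s \<noteq> u" and j: "j < n"
      and *: "A $$ (s, j) - A $$ (u, j) = \<mu> * (of_bool (j = s) - of_bool (j = u))" for s j
  proof -
    have "A $$ (s, j) = A $$ (u, j) + \<mu> * (of_bool (j = s) - of_bool (j = u))"
      using * by (simp add: algebra_simps)
    then show ?thesis
      using s by (simp add: entry[OF s(1) j] entry[OF lt(1) j] r_def)
  qed
  let ?M' = "mat n n (\<lambda>(a, j). if a = v then r v j else ?M $$ (a, j))"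
  have "det ?M = ?d * det ?M'"
    using lt ne by (intro det_scaled_row_diff[OF M, of v u] row_diff v) auto
  also have "det ?M' = ?d * det (mat n n (\<lambda>(a, j). if a = w then r w j else ?M' $$ (a, j)))"
    using lt ne row_diff[OF _ _ _ w] by (intro det_scaled_row_diff[of _ n w u]) auto
  finally show ?thesis
    unfolding char_poly_def power2_eq_square mult.assoc[symmetric] by (rule dvdI)
qed

section \<open>Twins and the Laplacian\<close>

lemma laplacian_carrier: "laplacian n G \<in> carrier_mat n n"
  unfolding laplacian_def degree_mat_def adjacency_mat_def
  by (rule minus_carrier_mat) simp

text \<open>
  Outside the columns \<open>u\<close> and \<open>v\<close> the rows agree because twins share their other neighbours. In
  these two columns, equality of the two degrees makes the difference the eigenvalue up to sign.
\<close>

lemma laplacian_twin_row_diff: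
  assumes G: "graph_on n G" and tw: "twins G u v" and j: "j < n"
  shows "laplacian n G $$ (u, j) - laplacian n G $$ (v, j) =
    (real (card (neighbours G u)) + of_bool (u \<rightarrow>\<^bsub>G\<^esub> v)) * (of_bool (j = u) - of_bool (j = v))"
proof -
  interpret graph G
    using G by (simp add: graph_on_def)
  have lt: "u < n" "v < n" and ne: "u \<noteq> v"
    using G tw by (auto simp: graph_on_def twins_def)
  have adj_sym: "(u \<rightarrow>\<^bsub>G\<^esub> v) = (v \<rightarrow>\<^bsub>G\<^esub> u)"
    using arcs_ends_symmetric[OF sym_arcs] by blast
  have no_loop: "\<not> x \<rightarrow>\<^bsub>G\<^esub> x" for x
    using adj_not_same by blast
  have same: "(u \<rightarrow>\<^bsub>G\<^esub> j) = (v \<rightarrow>\<^bsub>G\<^esub> j)" if "j \<noteq> u" "j \<noteq> v"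
    using tw that unfolding twins_def neighbours_def by blast
  have fin: "finite (neighbours G x)" for x
    by (rule finite_subset[OF _ finite_verts]) (auto simp: neighbours_def dest: adj_in_verts)
  have "card (neighbours G u) = card (neighbours G v)"
  proof (cases "u \<rightarrow>\<^bsub>G\<^esub> v")
    case True
    then have "v \<in> neighbours G u" "u \<in> neighbours G v"
      using adj_sym by (auto simp: neighbours_def)
    then show ?thesis
      using tw fin unfolding twins_def by (metis card.remove)
  next
    case False
    then have "neighbours G u = neighbours G v"
      using tw adj_sym by (auto simp: twins_def neighbours_def)
    then show ?thesis
      by simp
  qed
  moreover have "laplacian n G $$ (i, j) =
      (if i = j then real (card (neighbours G i)) else 0) - of_bool (i \<rightarrow>\<^bsub>G\<^esub> j)" if "i < n" for i
    using that j by (simp add: laplacian_def degree_mat_def adjacency_mat_def)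
  ultimately show ?thesis
    using lt ne no_loop same adj_sym by (cases "j = u"; cases "j = v") simp_all
qed

lemma twins_sym: "twins G u v \<longleftrightarrow> twins G v u"
  by (auto simp: twins_def)

text \<open>
  Two twins \<open>v\<close> and \<open>w\<close> of \<open>u\<close> give the same eigenvalue, since \<open>u\<close> is adjacent to both or to
  neither of them: adjacency of \<open>u\<close> and \<open>v\<close> passes to \<open>w\<close> and \<open>v\<close>, because \<open>w\<close> is a twin of \<open>u\<close>,
  and from there to \<open>u\<close> and \<open>w\<close>, because \<open>v\<close> is a twin of \<open>u\<close>. So \<open>char_poly_square_dvd\<close> applies.
\<close>

lemma twins_unique:
  assumes G: "graph_on n G" and simple: "simple_spectrum (laplacian n G)"
    and uv: "twins G u v" and uw: "twins G u w"
  shows "v = w"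
proof (rule ccontr)
  assume "v \<noteq> w"
  interpret graph G
    using G by (simp add: graph_on_def)
  have adj_sym: "(a \<rightarrow>\<^bsub>G\<^esub> b) = (b \<rightarrow>\<^bsub>G\<^esub> a)" for a b
    using arcs_ends_symmetric[OF sym_arcs] by blast
  have lt: "u < n" "v < n" "w < n" and ne: "u \<noteq> v" "u \<noteq> w"
    using G uv uw by (auto simp: graph_on_def twins_def)
  have "w \<in> neighbours G u \<longleftrightarrow> w \<in> neighbours G v" "v \<in> neighbours G u \<longleftrightarrow> v \<in> neighbours G w"
    using uv uw ne \<open>v \<noteq> w\<close> unfolding twins_def by blast+
  then have adj: "(u \<rightarrow>\<^bsub>G\<^esub> w) = (u \<rightarrow>\<^bsub>G\<^esub> v)"
    using adj_sym[of v w] by (simp add: neighbours_def)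
  define l where "l = real (card (neighbours G u)) + of_bool (u \<rightarrow>\<^bsub>G\<^esub> v)"
  let ?A = "map_mat complex_of_real (laplacian n G)"
  have L: "laplacian n G \<in> carrier_mat n n"
    by (rule laplacian_carrier)
  then have A: "?A \<in> carrier_mat n n"
    by simp
  have row_diff: "?A $$ (s, j) - ?A $$ (u, j) =
      complex_of_real l * (of_bool (j = s) - of_bool (j = u))"
    if s: "twins G u s" "s < n" "(u \<rightarrow>\<^bsub>G\<^esub> s) = (u \<rightarrow>\<^bsub>G\<^esub> v)" and j: "j < n" for s j
  proof -
    have "laplacian n G $$ (s, j) - laplacian n G $$ (u, j) = l * (of_bool (j = s) - of_bool (j = u))"
      using laplacian_twin_row_diff[OF G s(1) j] s(3) by (simp add: l_def algebra_simps)
    then show ?thesis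
      using L s(2) lt(1) j by (simp flip: of_real_diff)
  qed
  have sq: "[:- complex_of_real l, 1:] ^ 2 dvd char_poly ?A"
    using row_diff uv uw adj lt by (intro char_poly_square_dvd[OF A lt ne \<open>v \<noteq> w\<close>]) auto
  have "char_poly ?A \<noteq> 0"
    using degree_monic_char_poly[OF A] by auto
  then have order: "Polynomial.order (complex_of_real l) (char_poly ?A) \<ge> 2"
    using sq by (simp add: order_divides)
  then have "poly (char_poly ?A) (complex_of_real l) = 0"
    by (simp add: order_root)
  then have "eigenvalue ?A (complex_of_real l)"
    by (simp add: eigenvalue_root_char_poly[OF A])
  then show False
    using simple order by (auto simp: simple_spectrum_def)
qed

section \<open>Controllability\<close>

lemma span_index_eq:
  fixes S :: "'a :: field vec set"
  assumes S: "S \<subseteq> carrier_vec n" and eq: "\<And>x. x \<in> S \<Longrightarrow> x $ u = x $ v"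
    and lt: "u < n" "v < n"
    and y: "y \<in> LinearCombinations.module.span class_ring (module_vec TYPE('a) n) S"
  shows "y $ u = y $ v"
proof -
  interpret vec_space "TYPE('a)" n .
  obtain a X where X: "X \<subseteq> S" "y = lincomb a X"
    using y by (auto simp: span_def)
  then have "X \<subseteq> carrier_vec n"
    using S by auto
  then show ?thesis
    using X eq lt by (auto simp: lincomb_index intro!: sum.cong)
qed

lemma pow_mat_index_eq:
  fixes A :: "'a :: comm_ring_1 mat"
  assumes A: "A \<in> carrier_mat n n" and lt: "u < n" "v < n"
    and inv: "\<And>x. x \<in> carrier_vec n \<Longrightarrow> x $ u = x $ v \<Longrightarrow> (A *\<^sub>v x) $ u = (A *\<^sub>v x) $ v"
    and x: "x \<in> carrier_vec n" "x $ u = x $ v"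
  shows "(A ^\<^sub>m k *\<^sub>v x) $ u = (A ^\<^sub>m k *\<^sub>v x) $ v"
  using x
proof (induction k arbitrary: x)
  case 0
  then show ?case
    using A by simp
next
  case (Suc k)
  have "A ^\<^sub>m Suc k *\<^sub>v x = A ^\<^sub>m k *\<^sub>v (A *\<^sub>v x)"
    using A Suc.prems by (simp add: assoc_mult_mat_vec[of _ n n _ n])
  then show ?case
    using Suc inv A by (metis mult_mat_vec_carrier)
qed

lemma controllable_hits_twins:
  assumes G: "graph_on n G" and tw: "twins G u v"
    and ctrl: "controllable n (laplacian n G) (mat_of_cols n (map (unit_vec n) idx))"
  shows "u \<in> set idx \<or> v \<in> set idx"
proof (rule ccontr)
  assume no_control: "\<not> ?thesis"
  let ?L = "laplacian n G" and ?B = "mat_of_cols n (map (unit_vec n) idx) :: real mat"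
  have lt: "u < n" "v < n" and ne: "u \<noteq> v"
    using G tw by (auto simp: graph_on_def twins_def)
  have L: "?L \<in> carrier_mat n n"
    by (rule laplacian_carrier)
  have invariant: "(?L *\<^sub>v x) $ u = (?L *\<^sub>v x) $ v"
    if x: "x \<in> carrier_vec n" "x $ u = x $ v" for x
  proof -
    define l where "l = real (card (neighbours G u)) + of_bool (u \<rightarrow>\<^bsub>G\<^esub> v)"
    have "(?L *\<^sub>v x) $ u - (?L *\<^sub>v x) $ v = (\<Sum>j<n. (?L $$ (u, j) - ?L $$ (v, j)) * x $ j)"
      using L x lt
      by (simp add: scalar_prod_def sum_subtractf left_diff_distrib lessThan_atLeast0)
    also have "\<dots> = (\<Sum>j<n. (if j = u then l * x $ u else 0) - (if j = v then l * x $ v else 0))"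
      by (intro sum.cong) (auto simp: laplacian_twin_row_diff[OF G tw, folded l_def])
    also have "\<dots> = l * x $ u - l * x $ v"
      using lt by (simp add: sum_subtractf)
    finally show ?thesis
      using x by simp
  qed
  let ?S = "\<Union>k<n. set (cols (?L ^\<^sub>m k * ?B))"
  have S: "x \<in> carrier_vec n \<and> x $ u = x $ v" if "x \<in> ?S" for x
  proof -
    obtain k where "x \<in> set (cols (?L ^\<^sub>m k * ?B))"
      using \<open>x \<in> ?S\<close> by blast
    then obtain i where "i < length (cols (?L ^\<^sub>m k * ?B))" "cols (?L ^\<^sub>m k * ?B) ! i = x"
      unfolding in_set_conv_nth by blast
    then have i: "i < length idx" and x: "x = col (?L ^\<^sub>m k * ?B) i"
      by simp_all
    have Lk: "?L ^\<^sub>m k \<in> carrier_mat n n"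
      using L by simp
    have x': "x = ?L ^\<^sub>m k *\<^sub>v unit_vec n (idx ! i)"
      using col_mult2[OF Lk mat_of_cols_carrier(1), of i "map (unit_vec n) idx"] i
      by (simp add: x)
    have "idx ! i \<noteq> u" "idx ! i \<noteq> v"
      using no_control nth_mem[OF i] by auto
    then have "unit_vec n (idx ! i) $ u = (unit_vec n (idx ! i) $ v :: real)"
      using lt by (simp add: unit_vec_def)
    then have "x $ u = x $ v"
      unfolding x' by (intro pow_mat_index_eq[OF L lt invariant] unit_vec_carrier)
    moreover have "x \<in> carrier_vec n"
      unfolding x' by (rule mult_mat_vec_carrier[OF Lk unit_vec_carrier])
    ultimately show ?thesis
      by blast
  qed
  have "unit_vec n u \<in> LinearCombinations.module.span class_ring (module_vec TYPE(real) n) ?S"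
    using ctrl by (simp add: controllable_def)
  then have "unit_vec n u $ u = (unit_vec n u $ v :: real)"
    by (rule span_index_eq[rotated -1]) (use S lt in blast)+
  then show False
    using lt ne by simp
qed

lemma card_disjoint_hitting_le:
  assumes "finite I" and "pairwise disjnt P" and "\<And>X. X \<in> P \<Longrightarrow> X \<inter> I \<noteq> {}"
  shows "card P \<le> card I"
proof -
  define f where "f X = (SOME x. x \<in> X \<inter> I)" for X
  have f: "f X \<in> X \<inter> I" if "X \<in> P" for X
    unfolding f_def by (rule someI_ex) (use assms(3)[OF that] in blast)
  have "inj_on f P"
  proof (rule inj_onI)
    fix X Y assume "X \<in> P" "Y \<in> P" "f X = f Y"
    then show "X = Y"
      using f[of X] f[of Y] assms(2) by (auto simp: pairwise_def disjnt_def)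
  qed
  then show ?thesis
    using f assms(1) by (intro card_inj_on_le[of f]) auto
qed

theorem mainTheorem3:
  fixes n p :: nat and G :: "(nat, 'b) pre_digraph" and L B :: "real mat" and idx :: "nat list"
  assumes "twin_graph n G"
    and "L = laplacian n G"
    and "distinct idx" and "length idx = p" and "set idx \<subseteq> {0..<n}"
    and "B = mat_of_cols n (map (unit_vec n) idx)"
    and "controllable n L B"
  shows "\<lfloor>(real n - 1) / 2\<rfloor> \<le> int p"
proof -
  let ?P = "{{u, v} | u v. twins G u v}"
  have G: "graph_on n G" and simple: "simple_spectrum (laplacian n G)"
    and num: "int (num_twins G) = \<lfloor>(real n - 1) / 2\<rfloor>"
    using assms(1) by (auto simp: twin_graph_def)
  note unique = twins_unique[OF G simple]
  have "pairwise disjnt ?P"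
  proof (rule pairwiseI, rule ccontr)
    fix X Y assume X: "X \<in> ?P" and Y: "Y \<in> ?P" and ne: "X \<noteq> Y" and "\<not> disjnt X Y"
    then obtain a where a: "a \<in> X" "a \<in> Y"
      by (auto simp: disjnt_def)
    obtain b where b: "X = {a, b}" "twins G a b"
      using X a twins_sym[of G] by (auto simp: insert_commute)
    obtain c where c: "Y = {a, c}" "twins G a c"
      using Y a twins_sym[of G] by (auto simp: insert_commute)
    show False
      using unique[OF b(2) c(2)] b(1) c(1) ne by simp
  qed
  moreover have "X \<inter> set idx \<noteq> {}" if "X \<in> ?P" for X
    using that controllable_hits_twins[OF G] assms(2,6,7) by fastforce
  ultimately have "num_twins G \<le> card (set idx)"
    unfolding num_twins_def by (intro card_disjoint_hitting_le) auto
  then show ?thesis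
    using num assms(3,4) by (simp add: distinct_card)
qed

end
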